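(* For an arbitrary $\mathbf{a} = (a_1,\ldots,a_n) \in \mathbb{Z}^n$ we have $L(\mathbf{a}) \ll \log^2 \mathfrak{H}(\mathbf{a})$, where the implied constant may depend on $n$.
   Context: For $\mathbf{x} \in \mathbb{Z}^n$, the height is $\mathfrak{H}(\mathbf{x}) = \max\{|x_1|,\ldots,|x_n|\}$. For $\mathbf{a} \in \mathbb{Z}^n$, $L(\mathbf{a})$ denotes the smallest $H$ such that there is a vector $\mathbf{h} = (h_1,\ldots,h_n) \in \mathbb{Z}^n$ with $\mathfrak{H}(\mathbf{h}) = H$ and $\gcd(a_i+h_i, a_j+h_j) = 1$ for all $1 \le i < j \le n$. The notation $U \ll V$ means $|U| \le c|V|$ for some constant $c>0$.
   Formalization: The bound is stated for vectors a of height at least 2: for a = 0 the logarithm is undefined, and at height 1 it is 0 while e.g. a = (0,0,1) has L(a) = 1. *)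

theory Defs
  imports Complex_Main
begin

text \<open>
  A vector in \<open>\<int>\<^sup>n\<close> is given by a function \<open>x :: nat \<Rightarrow> int\<close> of which only
  the values at \<open>1, \<dots>, n\<close> are ever used. In dimension \<open>n = 0\<close> the height is an
  unspecified value, so \<open>n \<ge> 1\<close> has to be assumed where it is used.
\<close>

definition height :: "nat \<Rightarrow> (nat \<Rightarrow> int) \<Rightarrow> nat" where
  "height n x = Max ((\<lambda>i. nat \<bar>x i\<bar>) ` {1..n})"

definition pairwise_coprime_vec :: "nat \<Rightarrow> (nat \<Rightarrow> int) \<Rightarrow> bool" where
  "pairwise_coprime_vec n x \<longleftrightarrow> (\<forall>i j. 1 \<le> i \<and> i < j \<and> j \<le> n \<longrightarrow> gcd (x i) (x j) = 1)"

definition L :: "nat \<Rightarrow> (nat \<Rightarrow> int) \<Rightarrow> nat" where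
  "L n a = (LEAST H. \<exists>h. height n h = H \<and> pairwise_coprime_vec n (\<lambda>i. a i + h i))"

text \<open>The minimum defining \<open>L\<close> is always attained: every vector can be shifted to \<open>(1, \<dots>, 1)\<close>.
  Since \<open>gcd 0 0 = 0\<close>, the vector \<open>(0, 0, 1)\<close> has height \<open>1\<close> and \<open>L = 1\<close>, so an upper bound for \<open>L\<close>
  by a multiple of the squared logarithm of the height can only hold for heights \<open>\<ge> 2\<close>.\<close>

lemma L_attained: "\<exists>h. height n h = L n a \<and> pairwise_coprime_vec n (\<lambda>i. a i + h i)"
proof -
  have "pairwise_coprime_vec n (\<lambda>i. a i + (1 - a i))"
    by (simp add: pairwise_coprime_vec_def)
  then have "\<exists>H h. height n h = H \<and> pairwise_coprime_vec n (\<lambda>i. a i + h i)"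
    by (intro exI[of _ "height n (\<lambda>i. 1 - a i)"] exI[of _ "\<lambda>i. 1 - a i"]) simp
  then show ?thesis
    unfolding L_def by (rule LeastI_ex)
qed

end

theory Submission
  imports Defs "HOL-Computational_Algebra.Primes" "HOL-Library.FuncSet"
begin

text \<open>
  The proof is a union bound. Put \<open>W = D!\<close> with \<open>D\<close> of order \<open>n\<^sup>2\<close>, and only use shifts \<open>h\<^sub>i\<close> that
  make \<open>a\<^sub>i + h\<^sub>i\<close> congruent to \<open>1\<close> modulo \<open>W\<close>: a common prime factor \<open>p\<close> of two entries is then
  larger than \<open>D\<close>, and each entry runs through an arithmetic progression of length \<open>K\<close> that is
  equidistributed modulo \<open>p\<close>. For two fixed entries, the primes \<open>D < p \<le> K\<close> spoil at most
  \<open>\<Sum> (2 K / p)\<^sup>2 \<le> 4 K\<^sup>2 / D\<close> of the \<open>K\<^sup>2\<close> pairs. A prime \<open>p > K\<close> divides at most one member of each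
  progression, and each entry has \<open>O(log H)\<close> prime factors, so these primes spoil \<open>O(K log H)\<close>
  pairs. When \<open>K\<close> is a large multiple of \<open>log H\<close>, some choice of shifts is not spoilt by any pair;
  this even gives \<open>L = O(log H)\<close>.
\<close>

section \<open>Residue classes, prime divisors and a tail of inverse squares\<close>

text \<open>With the residue modulo \<open>p\<close> fixed, an element is determined by its
  quotient, which lies between \<open>0\<close> and \<open>(K - 1) div p\<close>.\<close>

lemma card_le_of_cong:
  fixes A :: "nat set"
  assumes "A \<subseteq> {..<K}" and "\<And>s t. s \<in> A \<Longrightarrow> t \<in> A \<Longrightarrow> s mod p = t mod p"
  shows "card A \<le> (K - 1) div p + 1"
proof -
  have "inj_on (\<lambda>s. s div p) A"
    by (rule inj_onI) (metis assms(2) div_mult_mod_eq)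
  moreover have "(\<lambda>s. s div p) ` A \<subseteq> {..(K - 1) div p}"
    using assms(1) by (auto intro!: div_le_mono)
  ultimately have "card A \<le> card {..(K - 1) div p}"
    by (intro card_inj_on_le) auto
  then show ?thesis by simp
qed

text \<open>Since \<open>W\<close> is invertible modulo \<open>p\<close>, divisibility by
  \<open>p\<close> pins \<open>s\<close> to a single residue class.\<close>

lemma card_progression_dvd:
  fixes b :: int and W :: nat
  assumes "coprime p W"
  shows "card {s. s < K \<and> int p dvd b + int W * int s} \<le> (K - 1) div p + 1"
proof (rule card_le_of_cong)
  fix s t
  assume "s \<in> {s. s < K \<and> int p dvd b + int W * int s}"
    and "t \<in> {s. s < K \<and> int p dvd b + int W * int s}"
  then have "int p dvd (b + int W * int s) - (b + int W * int t)"
    by (intro dvd_diff) auto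
  then have "int p dvd int W * (int s - int t)"
    by (simp add: algebra_simps)
  then have "int p dvd int s - int t"
    using assms by (simp add: coprime_dvd_mult_right_iff)
  then show "s mod p = t mod p"
    by (metis mod_eq_dvd_iff of_nat_eq_iff zmod_int)
qed auto

lemma prod_primes_dvd:
  fixes m :: nat
  assumes "finite P" and "\<And>p. p \<in> P \<Longrightarrow> prime p \<and> p dvd m"
  shows "\<Prod>P dvd m"
  using assms
proof (induction P rule: finite_induct)
  case (insert p P)
  have "coprime p (\<Prod>P)"
    using insert by (intro prod_coprime_right) (metis insertCI primes_coprime)
  then show ?case
    using insert by (simp add: divides_mult)
qed simp

text \<open>The product of distinct prime divisors divides \<open>m\<close>, and each factor is at
  least 2. This bounds the number of large primes dividing an entry by the logarithm of its
  size.\<close>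

lemma two_power_card_primes_le:
  fixes m :: nat
  assumes "finite P" and "\<And>p. p \<in> P \<Longrightarrow> prime p \<and> p dvd m" and "m > 0"
  shows "2 ^ card P \<le> m"
proof -
  have "2 ^ card P = (\<Prod>p\<in>P. 2::nat)" by simp
  also have "\<dots> \<le> \<Prod>P"
    by (intro prod_mono) (auto dest: assms(2) prime_ge_2_nat)
  also have "\<dots> \<le> m"
    using prod_primes_dvd[OF assms(1,2)] assms(3) by (auto intro: dvd_imp_le)
  finally show ?thesis .
qed

text \<open>Telescoping: \<open>1 / p^2\<close> is at most
  \<open>1 / (p - 1) - 1 / p\<close>.\<close>

lemma sum_inverse_squares_le:
  assumes "D > 0"
  shows "(\<Sum>p\<in>{D<..K}. 1 / (real p)\<^sup>2) \<le> 1 / real D"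
proof -
  have "(\<Sum>p\<in>{D<..D + k}. 1 / (real p)\<^sup>2) \<le> 1 / real D - 1 / real (D + k)" for k
  proof (induction k)
    case (Suc k)
    have "{D<..D + Suc k} = insert (D + Suc k) {D<..D + k}" by auto
    moreover have "1 / (real (D + Suc k))\<^sup>2 \<le> 1 / real (D + k) - 1 / real (D + Suc k)"
      using assms by (simp add: divide_simps power2_eq_square)
    ultimately show ?case using Suc by simp
  qed simp
  from this[of "K - D"] have "(\<Sum>p\<in>{D<..D + (K - D)}. 1 / (real p)\<^sup>2) \<le> 1 / real D"
    by (rule order_trans) simp
  moreover have "{D<..D + (K - D)} = {D<..K}" by auto
  ultimately show ?thesis by simp
qed

section \<open>Pairs of entries sharing a prime factor\<close>

lemma not_coprime_int_prime:
  fixes x y :: int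
  assumes "gcd x y \<noteq> 1"
  obtains p :: nat where "prime p" "int p dvd x" "int p dvd y"
proof -
  have "nat (gcd x y) \<noteq> 1"
    using assms by (simp add: nat_eq_iff)
  \<comment> \<open>The gcd may also be \<open>0\<close>, in which case every prime divides
    it.\<close>
  then obtain p where p: "prime p" "p dvd nat (gcd x y)"
    using prime_factor_nat by blast
  then have "int p dvd gcd x y"
    by (simp add: int_dvd_int_iff[symmetric])
  then show ?thesis using p that by auto
qed

text \<open>A prime up to \<open>D\<close> divides \<open>D!\<close>, hence \<open>x - 1\<close>; it
  cannot divide \<open>x\<close> as well.\<close>

lemma prime_dvd_cong_1_fact:
  fixes x :: int
  assumes "x mod int (fact D) = 1 mod int (fact D)" "prime p" "int p dvd x"
  shows "D < p"
proof (rule ccontr)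
  assume "\<not> D < p"
  then have "p dvd fact D"
    using assms(2) by (simp add: prime_dvd_fact_iff)
  then have "int p dvd int (fact D)" by (simp only: int_dvd_int_iff)
  moreover have "int (fact D) dvd x - 1"
    using assms(1) by (simp only: mod_eq_dvd_iff)
  ultimately have "int p dvd x - 1" using dvd_trans by blast
  then have "int p dvd x - (x - 1)" using assms(3) by (rule dvd_diff[rotated])
  then show False using assms(2) by (simp add: prime_nat_iff)
qed

text \<open>The first summand comes from primes up to \<open>K\<close>, the second from primes above
  \<open>K\<close>. The latter are counted as divisors of the first entry: each \<open>s\<close> has
  at most \<open>M\<close> of them, and each rules out at most one \<open>t\<close>.\<close>

lemma card_not_coprime_le:
  fixes b c :: int and D K M :: nat
  defines "W \<equiv> fact D"
  assumes "D > 1" "K > 0"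
    and b: "b mod int W = 1 mod int W" and c: "c mod int W = 1 mod int W"
    and M: "\<And>s. s < K \<Longrightarrow> \<bar>b + int W * int s\<bar> \<le> 2 ^ M"
  shows "real (card {(s, t). s < K \<and> t < K \<and> gcd (b + int W * int s) (c + int W * int t) \<noteq> 1})
    \<le> 4 * (real K)\<^sup>2 / real D + real K * real M" (is "real (card ?B) \<le> _")
proof -
  define Z where "Z d p = {s. s < K \<and> int p dvd d + int W * int s}" for d :: int and p :: nat
  define P where "P = {p. prime p \<and> D < p \<and> p \<le> K}"
  \<comment> \<open>\<open>K\<close> may be smaller than \<open>D\<close>, so \<open>D < p\<close>
    is demanded besides \<open>K < p\<close>; it makes \<open>p\<close> coprime to
    \<open>W\<close>.\<close>
  define Q where "Q s = {p. prime p \<and> K < p \<and> D < p \<and> int p dvd b + int W * int s}" for s :: nat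
  have coprime_W: "coprime p W" if "prime p" "D < p" for p
    using that unfolding W_def by (simp add: prime_imp_coprime prime_dvd_fact_iff)
  have card_Z: "card (Z d p) \<le> (K - 1) div p + 1" if "prime p" "D < p" for d p
    unfolding Z_def by (rule card_progression_dvd[OF coprime_W[OF that]])
  have finite_Z: "finite (Z d p)" for d p
    unfolding Z_def by simp
  have finite_P: "finite P"
    unfolding P_def by simp
  \<comment> \<open>A zero entry would have infinitely many prime divisors. The congruence to 1
    excludes it because \<open>D > 1\<close> gives \<open>W > 1\<close>.\<close>
  have nonzero: "b + int W * int s \<noteq> 0" for s
  proof
    assume "b + int W * int s = 0"
    then have "(b + int W * int s) mod int W = 0" by simp
    then have "1 mod int W = 0" using b by simp
    moreover have "int W > 1"
      using \<open>D > 1\<close> fact_ge_self[of D] unfolding W_def by linarith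
    ultimately show False by simp
  qed
  have Q: "finite (Q s)" "card (Q s) \<le> M" if "s < K" for s
  proof -
    let ?m = "nat \<bar>b + int W * int s\<bar>"
    have dvd: "p dvd ?m" if "p \<in> Q s" for p
      using that unfolding Q_def by (simp add: nat_dvd_iff flip: int_dvd_int_iff)
    have "?m > 0" using nonzero[of s] by simp
    moreover have "Q s \<subseteq> {p. p dvd ?m}"
      by (intro subsetI CollectI dvd)
    ultimately show fin: "finite (Q s)"
      by (metis finite_divisors_nat finite_subset)
    have "2 ^ card (Q s) \<le> ?m"
      using fin dvd \<open>?m > 0\<close> by (intro two_power_card_primes_le) (auto simp: Q_def)
    also have "?m \<le> 2 ^ M"
      using M[OF that] by (simp add: nat_le_iff)
    finally show "card (Q s) \<le> M" by simp
  qed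
  have "?B \<subseteq> (\<Union>p\<in>P. Z b p \<times> Z c p) \<union> (\<Union>s\<in>{..<K}. \<Union>p\<in>Q s. {s} \<times> Z c p)"
  proof clarify
    fix s t
    assume st: "s < K" "t < K" "gcd (b + int W * int s) (c + int W * int t) \<noteq> 1"
      and not: "(s, t) \<notin> (\<Union>s\<in>{..<K}. \<Union>p\<in>Q s. {s} \<times> Z c p)"
    then obtain p where p: "prime p" "int p dvd b + int W * int s" "int p dvd c + int W * int t"
      using not_coprime_int_prime by blast
    have "D < p"
      using p b by (intro prime_dvd_cong_1_fact[of "b + int W * int s"]) (auto simp: W_def)
    then show "(s, t) \<in> (\<Union>p\<in>P. Z b p \<times> Z c p)"
      using st p not by (cases "p \<le> K") (auto simp: P_def Q_def Z_def)
  qed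
  then have "card ?B \<le> card ((\<Union>p\<in>P. Z b p \<times> Z c p) \<union> (\<Union>s\<in>{..<K}. \<Union>p\<in>Q s. {s} \<times> Z c p))"
    using finite_P finite_Z Q(1) by (intro card_mono) auto
  also have "\<dots> \<le> card (\<Union>p\<in>P. Z b p \<times> Z c p) + card (\<Union>s\<in>{..<K}. \<Union>p\<in>Q s. {s} \<times> Z c p)"
    by (rule card_Un_le)
  also have "\<dots> \<le> (\<Sum>p\<in>P. card (Z b p \<times> Z c p)) + (\<Sum>s<K. \<Sum>p\<in>Q s. card ({s} \<times> Z c p))"
    using finite_P Q(1)
    by (intro add_mono card_UN_le order_trans[OF card_UN_le sum_mono]) auto
  finally have split: "card ?B \<le>
      (\<Sum>p\<in>P. card (Z b p \<times> Z c p)) + (\<Sum>s<K. \<Sum>p\<in>Q s. card ({s} \<times> Z c p))" .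

  have card_Z_real: "real (card (Z d p)) \<le> 2 * real K / real p" if "p \<in> P" for d p
  proof -
    have p: "prime p" "D < p" "p \<le> K" using that by (auto simp: P_def)
    have "real (card (Z d p)) \<le> real ((K - 1) div p) + 1"
      using card_Z[OF p(1,2), of d] by linarith
    also have "real ((K - 1) div p) \<le> real (K - 1) / real p"
      by (rule of_nat_div_le_of_nat)
    also have "\<dots> \<le> real K / real p"
      by (intro divide_right_mono) auto
    \<comment> \<open>The extra 1 in the count is absorbed because \<open>p \<le> K\<close>, whence
      the factor 2.\<close>
    also have "(1::real) \<le> real K / real p"
      using p by simp
    finally show ?thesis by simp
  qed
  have "real (\<Sum>p\<in>P. card (Z b p \<times> Z c p)) = (\<Sum>p\<in>P. real (card (Z b p)) * real (card (Z c p)))"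
    by (simp add: card_cartesian_product)
  also have "\<dots> \<le> (\<Sum>p\<in>P. (2 * real K / real p) * (2 * real K / real p))"
    by (intro sum_mono mult_mono card_Z_real) auto
  also have "\<dots> = 4 * (real K)\<^sup>2 * (\<Sum>p\<in>P. 1 / (real p)\<^sup>2)"
    by (simp add: sum_distrib_left power2_eq_square)
  also have "\<dots> \<le> 4 * (real K)\<^sup>2 * (\<Sum>p\<in>{D<..K}. 1 / (real p)\<^sup>2)"
    by (intro mult_left_mono sum_mono2) (auto simp: P_def)
  also have "\<dots> \<le> 4 * (real K)\<^sup>2 * (1 / real D)"
    using \<open>D > 1\<close> by (intro mult_left_mono sum_inverse_squares_le) auto
  finally have small: "real (\<Sum>p\<in>P. card (Z b p \<times> Z c p)) \<le> 4 * (real K)\<^sup>2 / real D"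
    by simp

  have "(\<Sum>s<K. \<Sum>p\<in>Q s. card ({s} \<times> Z c p)) \<le> (\<Sum>s<K. \<Sum>p\<in>Q s. 1)"
  proof (intro sum_mono)
    fix s p assume "p \<in> Q s"
    then have p: "prime p" "D < p" "K < p" by (auto simp: Q_def)
    then have "(K - 1) div p = 0" by simp
    then show "card ({s} \<times> Z c p) \<le> 1"
      using card_Z[OF p(1,2), of c] by (simp add: card_cartesian_product)
  qed
  also have "\<dots> \<le> (\<Sum>s<K. M)"
    using Q by (intro sum_mono) auto
  finally have "(\<Sum>s<K. \<Sum>p\<in>Q s. card ({s} \<times> Z c p)) \<le> K * M"
    by simp
  then have "real (\<Sum>s<K. \<Sum>p\<in>Q s. card ({s} \<times> Z c p)) \<le> real K * real M"
    by (simp only: of_nat_mult[symmetric] of_nat_le_iff)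
  with small have "real ((\<Sum>p\<in>P. card (Z b p \<times> Z c p)) + (\<Sum>s<K. \<Sum>p\<in>Q s. card ({s} \<times> Z c p)))
      \<le> 4 * (real K)\<^sup>2 / real D + real K * real M"
    by (simp only: of_nat_add)
  moreover have "real (card ?B) \<le>
      real ((\<Sum>p\<in>P. card (Z b p \<times> Z c p)) + (\<Sum>s<K. \<Sum>p\<in>Q s. card ({s} \<times> Z c p)))"
    using split by (simp only: of_nat_le_iff)
  ultimately show ?thesis by linarith
qed

section \<open>The union bound over all choices of shifts\<close>

text \<open>A choice is determined by its values at \<open>i\<close> and \<open>j\<close> together
  with its restriction to the other indices.\<close>

lemma card_PiE_pair_le:
  assumes "finite I" "finite S" "i \<in> I" "j \<in> I" "i \<noteq> j" "B \<subseteq> S \<times> S"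
  shows "card {t \<in> I \<rightarrow>\<^sub>E S. (t i, t j) \<in> B} \<le> card B * card S ^ (card I - 2)"
proof -
  let ?T = "{t \<in> I \<rightarrow>\<^sub>E S. (t i, t j) \<in> B}" and ?J = "I - {i, j}"
  let ?f = "\<lambda>t. ((t i, t j), restrict t ?J)"
  have "inj_on ?f ?T"
  proof (rule inj_onI)
    fix t u
    assume tu: "t \<in> ?T" "u \<in> ?T" "?f t = ?f u"
    show "t = u"
    proof (rule PiE_ext[of t I "\<lambda>_. S" u])
      fix k assume "k \<in> I"
      show "t k = u k"
      proof (cases "k \<in> ?J")
        case True
        then show ?thesis using tu(3) by (metis prod.inject restrict_apply')
      next
        case False
        then show ?thesis using tu(3) \<open>k \<in> I\<close> by auto
      qed
    qed (use tu in auto)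
  qed
  moreover have "?f ` ?T \<subseteq> B \<times> (?J \<rightarrow>\<^sub>E S)"
  proof (intro image_subsetI SigmaI)
    fix t assume "t \<in> ?T"
    then show "(t i, t j) \<in> B" by simp
    show "restrict t ?J \<in> ?J \<rightarrow>\<^sub>E S"
      using \<open>t \<in> ?T\<close> by (simp only: restrict_PiE_iff) (blast intro: PiE_mem)
  qed
  moreover have "finite (B \<times> (?J \<rightarrow>\<^sub>E S))"
    using assms by (auto intro!: finite_cartesian_product finite_PiE intro: finite_subset)
  ultimately have "card ?T \<le> card (B \<times> (?J \<rightarrow>\<^sub>E S))"
    by (rule card_inj_on_le)
  also have "\<dots> = card B * card S ^ card ?J"
    using assms by (simp add: card_cartesian_product card_PiE)
  also have "card ?J = card I - 2"
    using assms by (simp add: card_Diff_subset)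
  finally show ?thesis .
qed

text \<open>With \<open>N = card I\<close>, there are at most \<open>N^2\<close> pairs of indices,
  and each spoils less than the fraction \<open>1 / N^2\<close> of all choices.\<close>

lemma ex_avoiding_pairs:
  fixes I :: "nat set" and B :: "nat \<Rightarrow> nat \<Rightarrow> ('a \<times> 'a) set"
  assumes "finite I" "finite S" "S \<noteq> {}"
    and B: "\<And>i j. i \<in> I \<Longrightarrow> j \<in> I \<Longrightarrow> i < j \<Longrightarrow>
      B i j \<subseteq> S \<times> S \<and> (card I)\<^sup>2 * card (B i j) < (card S)\<^sup>2"
  obtains t where "t \<in> I \<rightarrow>\<^sub>E S" "\<And>i j. i \<in> I \<Longrightarrow> j \<in> I \<Longrightarrow> i < j \<Longrightarrow> (t i, t j) \<notin> B i j"
proof (cases "\<exists>i\<in>I. \<exists>j\<in>I. i < j")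
  \<comment> \<open>Without any pair every choice works. The case is separate because the strict
    comparison of sums below needs a nonempty index set.\<close>
  case False
  then show ?thesis
    using that[of "restrict (\<lambda>_. SOME x. x \<in> S) I"] assms(3) by (auto simp: some_in_eq)
next
  case True
  define N K where "N = card I" and "K = card S"
  define R where "R = {(i, j). i \<in> I \<and> j \<in> I \<and> i < j}"
  define T where "T i j = {t \<in> I \<rightarrow>\<^sub>E S. (t i, t j) \<in> B i j}" for i j
  have K: "K > 0"
    using assms by (simp add: K_def card_gt_0_iff)
  have "R \<subseteq> I \<times> I" by (auto simp: R_def)
  then have R: "finite R" "card R \<le> N\<^sup>2"
    using assms(1) card_mono[of "I \<times> I" R]
    by (auto simp: N_def card_cartesian_product power2_eq_square intro: finite_subset)
  have "R \<noteq> {}" using True by (auto simp: R_def)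
  have N: "N \<ge> 2"
  proof -
    obtain i j where ij: "i \<in> I" "j \<in> I" "i < j" using True by blast
    then have "card {i, j} \<le> N"
      unfolding N_def using assms(1) by (intro card_mono) auto
    then show ?thesis using ij by simp
  qed
  have T_less: "N\<^sup>2 * card (T i j) < K ^ N" if "(i, j) \<in> R" for i j
  proof -
    have ij: "i \<in> I" "j \<in> I" "i < j" using that by (auto simp: R_def)
    have "N\<^sup>2 * card (T i j) \<le> N\<^sup>2 * (card (B i j) * K ^ (N - 2))"
      unfolding T_def N_def K_def using ij B[OF ij] assms(1,2)
      by (intro mult_left_mono card_PiE_pair_le) auto
    also have "\<dots> = (N\<^sup>2 * card (B i j)) * K ^ (N - 2)" by simp
    also have "\<dots> < K\<^sup>2 * K ^ (N - 2)"
      using B[OF ij] K by (intro mult_strict_right_mono) (auto simp: N_def K_def)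
    also have "\<dots> = K ^ N"
      using N power_add[of K 2 "N - 2"] by (simp only: le_add_diff_inverse)
    finally show ?thesis .
  qed
  have "N\<^sup>2 * card (\<Union>(i, j)\<in>R. T i j) \<le> N\<^sup>2 * (\<Sum>(i, j)\<in>R. card (T i j))"
    using card_UN_le[OF R(1), of "\<lambda>(i, j). T i j"]
    by (intro mult_left_mono) (auto simp: case_prod_unfold)
  also have "\<dots> = (\<Sum>(i, j)\<in>R. N\<^sup>2 * card (T i j))"
    by (simp add: sum_distrib_left case_prod_unfold)
  also have "\<dots> < (\<Sum>(i, j)\<in>R. K ^ N)"
    using R(1) \<open>R \<noteq> {}\<close> T_less by (intro sum_strict_mono) auto
  also have "\<dots> = card R * K ^ N" by simp
  also have "\<dots> \<le> N\<^sup>2 * K ^ N"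
    using R(2) by (rule mult_right_mono) simp
  finally have "card (\<Union>(i, j)\<in>R. T i j) < K ^ N" by simp
  also have "K ^ N = card (I \<rightarrow>\<^sub>E S)"
    using assms(1) by (simp add: card_PiE K_def N_def)
  finally have "\<not> card (I \<rightarrow>\<^sub>E S) \<le> card (\<Union>(i, j)\<in>R. T i j)" by simp
  then have "\<not> (I \<rightarrow>\<^sub>E S) \<subseteq> (\<Union>(i, j)\<in>R. T i j)"
  proof (rule contrapos_nn)
    have "finite (T i j)" for i j
      using finite_PiE[of I "\<lambda>_. S"] assms(1,2) by (simp add: T_def)
    then show "card (I \<rightarrow>\<^sub>E S) \<le> card (\<Union>(i, j)\<in>R. T i j)"
      if "(I \<rightarrow>\<^sub>E S) \<subseteq> (\<Union>(i, j)\<in>R. T i j)"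
      using R(1) that by (intro card_mono) auto
  qed
  then obtain t where "t \<in> I \<rightarrow>\<^sub>E S" "t \<notin> (\<Union>(i, j)\<in>R. T i j)" by blast
  then show ?thesis using that[of t] by (auto simp: R_def T_def)
qed

section \<open>Choice of constants and the final estimate\<close>

text \<open>The witness is \<open>3 * A\<close>, by cubing \<open>A + 1 \<le> 2 ^ A\<close>. The
  factor \<open>s + 1\<close> lets \<open>s\<close> be fixed although the range of shifts itself
  grows with \<open>s\<close>.\<close>

lemma linear_le_two_power: "\<exists>s::nat. A * (s + 1) \<le> 2 ^ s"
proof
  have "A * (3 * A + 1) \<le> (A + 1) ^ 3"
    by (simp add: power3_eq_cube algebra_simps)
  also have "\<dots> \<le> (2 ^ A) ^ 3"
    by (intro power_mono) (simp_all add: Suc_leI)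
  also have "\<dots> = 2 ^ (3 * A)"
    by (simp add: power_mult[symmetric] mult.commute)
  finally show "A * (3 * A + 1) \<le> 2 ^ (3 * A)" .
qed

theorem theorem2:
  fixes n :: nat
  assumes "n \<ge> 1"
  shows "\<exists>c::real. c > 0 \<and>
    (\<forall>a :: nat \<Rightarrow> int. height n a \<ge> 2 \<longrightarrow>
      real (L n a) \<le> c * (ln (real (height n a)))\<^sup>2)"
proof -
  \<comment> \<open>With this \<open>D\<close> the small primes contribute \<open>K^2 / 4\<close>
    after multiplication by \<open>n^2\<close>.\<close>
  define D where "D = 16 * n\<^sup>2"
  define W :: nat where "W = fact D"
  \<comment> \<open>\<open>s\<close> depends on \<open>n\<close> only. It keeps all shifted entries
    below \<open>2 ^ (l + s)\<close>, while \<open>C\<close> makes \<open>K = C * l\<close> at least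
    \<open>2 * n^2 * (l + s)\<close>, so that the large primes contribute at most
    \<open>K^2 / 2\<close>.\<close>
  obtain s where s: "(2 + 2 * n\<^sup>2 * W) * (s + 1) \<le> 2 ^ s"
    using linear_le_two_power by blast
  define C where "C = 2 * n\<^sup>2 * (s + 1)"
  have "W > 0" "n\<^sup>2 > 0" using assms by (auto simp: W_def)
  then have "D > 1" unfolding D_def by linarith
  have "C > 0" using assms by (simp add: C_def)
  have bound: "real (L n a) \<le> real (W * C) / (ln 2)\<^sup>2 * (ln (real (height n a)))\<^sup>2"
    if "height n a \<ge> 2" for a :: "nat \<Rightarrow> int"
  proof -
    define H where "H = height n a"
    have "H \<ge> 2" using that by (simp add: H_def)
    \<comment> \<open>\<open>l\<close> is the integer part of the binary logarithm of
      \<open>H\<close>.\<close>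
    obtain l where l: "2 ^ l \<le> H" "H < 2 ^ (l + 1)"
      using ex_power_ivl1[of 2 H] \<open>H \<ge> 2\<close> by auto
    have "l \<ge> 1"
      using l(2) \<open>H \<ge> 2\<close> by (cases l) auto
    define K where "K = C * l"
    have "K > 0" using \<open>C > 0\<close> \<open>l \<ge> 1\<close> by (simp add: K_def)
    have a_le: "\<bar>a i\<bar> \<le> int H" if "i \<in> {1..n}" for i
    proof -
      have "nat \<bar>a i\<bar> \<le> H"
        unfolding H_def height_def using that by (intro Max_ge) auto
      then show ?thesis by simp
    qed
    \<comment> \<open>The crude bound \<open>l \<le> 2 ^ l\<close> suffices here, as it allows
      \<open>2 ^ l\<close> to be factored out.\<close>
    have "H + W * K \<le> 2 ^ l * 2 + W * (C * 2 ^ l)"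
      using l(2) by (intro add_mono) (auto simp: K_def less_imp_le)
    also have "\<dots> = 2 ^ l * (2 + 2 * n\<^sup>2 * W * (s + 1))"
      by (simp add: C_def algebra_simps)
    also have "\<dots> \<le> 2 ^ l * ((2 + 2 * n\<^sup>2 * W) * (s + 1))"
      by (intro mult_left_mono) (auto simp: algebra_simps)
    also have "\<dots> \<le> 2 ^ l * 2 ^ s"
      using s by (rule mult_left_mono) simp
    finally have HWK: "H + W * K \<le> 2 ^ (l + s)"
      by (simp add: power_add)

    \<comment> \<open>The least nonnegative shift that makes the entry congruent to 1 modulo
      \<open>W\<close>.\<close>
    define r where "r i = (1 - a i) mod int W" for i
    define b where "b i = a i + r i" for i
    have r: "0 \<le> r i" "r i < int W" for i
      using \<open>W > 0\<close> by (auto simp: r_def)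
    have b: "b i mod int W = 1 mod int W" for i
      unfolding b_def r_def by (simp add: mod_add_right_eq)
    have shift_le: "r i + int W * int t \<le> int (W * K)" if "t < K" for i t
    proof -
      have "r i + int W * int t \<le> int W * (int t + 1)"
        using r(2)[of i] by (simp add: algebra_simps)
      also have "\<dots> \<le> int W * int K"
        using that by (intro mult_left_mono) auto
      finally show ?thesis by simp
    qed
    have entry_le: "\<bar>b i + int W * int t\<bar> \<le> 2 ^ (l + s)" if "i \<in> {1..n}" "t < K" for i t
    proof -
      have "\<bar>b i + int W * int t\<bar> \<le> \<bar>a i\<bar> + \<bar>r i + int W * int t\<bar>"
        by (simp add: b_def)
      also have "\<bar>r i + int W * int t\<bar> = r i + int W * int t"
        using r(1)[of i] by (simp add: abs_of_nonneg)
      also have "\<bar>a i\<bar> + (r i + int W * int t) \<le> int H + int (W * K)"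
        by (rule add_mono[OF a_le[OF that(1)] shift_le[OF that(2)]])
      also have "\<dots> = int (H + W * K)" by simp
      also have "\<dots> \<le> int (2 ^ (l + s))" using HWK by (simp only: of_nat_le_iff)
      finally show ?thesis by simp
    qed

    define B where "B i j = {(u, v). u < K \<and> v < K \<and>
      gcd (b i + int W * int u) (b j + int W * int v) \<noteq> 1}" for i j
    have large: "real (2 * n\<^sup>2 * (l + s)) \<le> real K"
    proof -
      have "l + s \<le> (s + 1) * l" using \<open>l \<ge> 1\<close> by simp
      then have "2 * n\<^sup>2 * (l + s) \<le> 2 * n\<^sup>2 * ((s + 1) * l)"
        by (rule mult_left_mono) simp
      also have "\<dots> = K" by (simp only: K_def C_def mult.assoc)
      finally show ?thesis by (simp only: of_nat_le_iff)
    qed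
    have card_B: "n\<^sup>2 * card (B i j) < K\<^sup>2" if "i \<in> {1..n}" for i j
    proof -
      have "real (card (B i j)) \<le> 4 * (real K)\<^sup>2 / real D + real K * real (l + s)"
        unfolding B_def W_def using \<open>D > 1\<close> \<open>K > 0\<close> b entry_le[OF that]
        by (intro card_not_coprime_le) (auto simp: W_def)
      then have "real (n\<^sup>2) * real (card (B i j)) \<le>
          real (n\<^sup>2) * (4 * (real K)\<^sup>2 / real D + real K * real (l + s))"
        by (intro mult_left_mono) auto
      also have "\<dots> = (real K)\<^sup>2 / 4 + real K * real (2 * n\<^sup>2 * (l + s)) / 2"
        using assms by (simp add: D_def field_simps)
      also have "\<dots> \<le> (real K)\<^sup>2 / 4 + real K * real K / 2"
        using large by (intro add_left_mono divide_right_mono mult_left_mono) auto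
      also have "\<dots> < (real K)\<^sup>2"
        using \<open>K > 0\<close> by (simp add: power2_eq_square)
      finally have "real (n\<^sup>2 * card (B i j)) < real (K\<^sup>2)"
        by (simp only: of_nat_mult of_nat_power)
      then show ?thesis by (simp only: of_nat_less_iff)
    qed
    obtain t where t: "t \<in> {1..n} \<rightarrow>\<^sub>E {..<K}"
      and avoid: "\<And>i j. i \<in> {1..n} \<Longrightarrow> j \<in> {1..n} \<Longrightarrow> i < j \<Longrightarrow> (t i, t j) \<notin> B i j"
    proof (rule ex_avoiding_pairs[of "{1..n}" "{..<K}" B])
      fix i j assume "i \<in> {1..n}"
      then show "B i j \<subseteq> {..<K} \<times> {..<K} \<and> (card {1..n})\<^sup>2 * card (B i j) < (card {..<K})\<^sup>2"
        using card_B by (auto simp: B_def)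
    qed (use \<open>K > 0\<close> in auto)
    have tK: "t i < K" if "i \<in> {1..n}" for i
      using t that by auto

    define h where "h i = r i + int W * int (t i)" for i
    have "pairwise_coprime_vec n (\<lambda>i. a i + h i)"
      unfolding pairwise_coprime_vec_def
    proof (intro allI impI)
      fix i j assume "1 \<le> i \<and> i < j \<and> j \<le> n"
      then show "gcd (a i + h i) (a j + h j) = 1"
        using avoid[of i j] tK[of i] tK[of j] by (auto simp: B_def b_def h_def add.assoc)
    qed
    then have "L n a \<le> height n h"
      unfolding L_def by (intro Least_le) auto
    also have "\<dots> \<le> W * K"
      unfolding height_def
    proof (rule Max.boundedI)
      fix x assume "x \<in> (\<lambda>i. nat \<bar>h i\<bar>) ` {1..n}"
      then obtain i where i: "i \<in> {1..n}" "x = nat \<bar>h i\<bar>" by auto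
      moreover have "0 \<le> h i" using r(1)[of i] by (simp add: h_def)
      ultimately show "x \<le> W * K"
        using shift_le[OF tK[OF i(1)], of i] by (simp add: h_def nat_le_iff)
    qed (use assms in auto)
    finally have "L n a \<le> (W * C) * l" by (simp add: K_def)
    \<comment> \<open>The bound obtained is linear in \<open>l\<close>; it is weakened to the square
      of the statement.\<close>
    also have "\<dots> \<le> (W * C) * l\<^sup>2"
      using \<open>l \<ge> 1\<close> by (intro mult_left_mono) (auto simp: power2_eq_square)
    finally have L_le: "real (L n a) \<le> real (W * C) * (real l)\<^sup>2"
      by (metis of_nat_le_iff of_nat_mult of_nat_power)
    have "real l * ln 2 = ln (2 ^ l)" by (simp add: ln_realpow)
    also have "\<dots> \<le> ln (real H)"
    proof (rule ln_mono)
      have "real (2 ^ l) \<le> real H" using l(1) by (simp only: of_nat_le_iff)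
      then show "2 ^ l \<le> real H" by simp
    qed (use \<open>H \<ge> 2\<close> in auto)
    finally have "real l \<le> ln (real H) / ln 2"
      by (simp add: field_simps)
    then have "(real l)\<^sup>2 \<le> (ln (real H) / ln 2)\<^sup>2"
      by (rule power_mono) simp
    then have "real (W * C) * (real l)\<^sup>2 \<le> real (W * C) * (ln (real H) / ln 2)\<^sup>2"
      by (rule mult_left_mono) simp
    with L_le show ?thesis
      by (simp add: H_def power_divide)
  qed
  moreover have "real (W * C) / (ln 2)\<^sup>2 > 0"
    using \<open>W > 0\<close> \<open>C > 0\<close> by simp
  ultimately show ?thesis by blast
qed

end
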